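(* Let $a\in\mathbb{N}$, $c\geq 1$, and let $(k_i)_{i\in\mathbb{N}}$ be integers with $2\leq k_1\leq k_2\leq\cdots$. Define $W_0=1$ and $W_i=\mathbf{W}(k_i,c^{W_0W_1\cdots W_{i-1}})$ for $i\in\mathbb{N}$. Let $l_1,l_2,\dots$ be positive integers such that for every $i\geq 2$, $l_i>(W_1-1)l_1+\cdots+(W_{i-1}-1)l_{i-1}$. For $i\in\mathbb{N}$ let \[ A_i=\{a+x_1l_1+\cdots+x_il_i \mid 0\leq x_1\leq W_1-1,\dots,0\leq x_i\leq W_i-1\}, \] and let $A=\bigcup_{i\in\mathbb{N}}A_i$. Then for any $c$-coloring of $A$ there exist positive integers $a_i,d_i$ ($i\in\mathbb{N}$), where $d_i=\alpha_il_i$ for some integer $\alpha_i$ with $1\leq\alpha_i\leq\lfloor\frac{W_i-1}{k_i-1}\rfloor$, such that the sets \[ \{a_i+x_1d_1+\cdots+x_id_i \mid 0\leq x_1\leq k_1-1,\dots,0\leq x_i\leq k_i-1\},\quad i\in\mathbb{N}, \] are all contained in $A$ and are all monochromatic with the same color.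
   Context: $\mathbb{N}$ is the set of positive integers. A $c$-coloring is a map into $[c]=\{1,\dots,c\}$. For integers $k\geq 2$ and $c\geq 1$, $\mathbf{W}(k,c)$ denotes the van der Waerden number: the least integer $N$ such that every $c$-coloring of $\{1,\dots,N\}$ contains a monochromatic arithmetic progression of length $k$. *)

theory Defs
  imports Main "HOL-Library.FuncSet"
begin

definition monochromatic :: "(nat \<Rightarrow> nat) \<Rightarrow> nat \<Rightarrow> nat set \<Rightarrow> bool" where
  "monochromatic f q S \<longleftrightarrow> (\<forall>y\<in>S. f y = q)"

definition arith_prog :: "nat \<Rightarrow> nat \<Rightarrow> nat \<Rightarrow> nat set" where
  "arith_prog b d k = {b + j * d | j. j < k}"

text \<open>The van der Waerden number. The least element exists for all \<open>k\<close> and \<open>c\<close> by van der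
  Waerden's theorem, which is not proved here.\<close>

definition vdW :: "nat \<Rightarrow> nat \<Rightarrow> nat" where
  "vdW k c = (LEAST N. \<forall>f \<in> {1..N} \<rightarrow> {1..c}.
      \<exists>b d q. d > 0 \<and> arith_prog b d k \<subseteq> {1..N} \<and> monochromatic f q (arith_prog b d k))"

text \<open>Sequences indexed by the positive integers are functions on \<^typ>\<open>nat\<close> whose value at
  \<open>0\<close> is never used; only \<open>vdW_seq\<close> has a meaningful term at index \<open>0\<close>.\<close>

fun vdW_seq :: "(nat \<Rightarrow> nat) \<Rightarrow> nat \<Rightarrow> nat \<Rightarrow> nat" where
  "vdW_seq k c 0 = 1"
| "vdW_seq k c (Suc i) = vdW (k (Suc i)) (c ^ (\<Prod>j\<in>{0..i}. vdW_seq k c j))"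

definition gen_prog :: "nat \<Rightarrow> (nat \<Rightarrow> nat) \<Rightarrow> (nat \<Rightarrow> nat) \<Rightarrow> nat \<Rightarrow> nat set" where
  "gen_prog a d m i = {a + (\<Sum>j=1..i. x j * d j) | x. \<forall>j\<in>{1..i}. 0 \<le> x j \<and> x j \<le> m j - 1}"

end

theory Submission
  imports Defs "HOL-Library.Diagonal_Subsequence" "HOL-Library.Infinite_Set"
begin

text \<open>For a fixed level \<open>n\<close>, colour each \<open>t < W\<^sub>n\<close> by the restriction of the colouring to
  \<open>A\<^sub>n\<^sub>-\<^sub>1 + t l\<^sub>n\<close>. As \<open>A\<^sub>n\<^sub>-\<^sub>1\<close> has at most \<open>W\<^sub>0 \<cdots> W\<^sub>n\<^sub>-\<^sub>1\<close> elements, van der Waerden's theorem gives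
  an arithmetic progression of translates of \<open>A\<^sub>n\<^sub>-\<^sub>1\<close> that are all coloured alike, and one recurses
  into the first of them. The multipliers and the colour found this way depend on \<open>n\<close>, but each
  ranges over a finite set, so a diagonal argument produces a single choice for all levels.
  Van der Waerden's theorem itself is obtained by colour focusing: if progressions of length \<open>k\<close> in
  \<open>r\<close> different colours would all continue with the same point \<open>z\<close>, then either the colour of \<open>z\<close>
  is one of these and prolongs a progression, or van der Waerden's theorem for length \<open>k\<close>, applied
  to the colour patterns of long blocks of integers, yields \<open>r + 1\<close> such progressions; and \<open>r\<close>
  cannot exceed the number of colours.\<close>

section \<open>Van der Waerden's theorem\<close>

definition constant_ap :: "(nat \<Rightarrow> 'a) \<Rightarrow> nat \<Rightarrow> nat \<Rightarrow> nat \<Rightarrow> bool" where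
  "constant_ap f k b d \<longleftrightarrow> 0 < d \<and> (\<forall>j<k. f (b + j * d) = f b)"

definition has_constant_ap :: "nat \<Rightarrow> nat \<Rightarrow> (nat \<Rightarrow> 'a) \<Rightarrow> bool" where
  "has_constant_ap N k f \<longleftrightarrow> (\<exists>b d. constant_ap f k b d \<and> (\<forall>j<k. b + j * d < N))"

definition vdW_bound :: "nat \<Rightarrow> 'a set \<Rightarrow> nat \<Rightarrow> bool" where
  "vdW_bound k S N \<longleftrightarrow> (\<forall>f \<in> {..<N} \<rightarrow> S. has_constant_ap N k f)"

lemma has_constant_ap_shift:
  assumes "has_constant_ap N k (\<lambda>y. f (p + y))" and "p + N \<le> N'"
  shows "has_constant_ap N' k f"
proof -
  obtain b d where "constant_ap (\<lambda>y. f (p + y)) k b d" and lt: "\<forall>j<k. b + j * d < N"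
    using assms(1) unfolding has_constant_ap_def by blast
  then have "constant_ap f k (p + b) d" by (simp add: constant_ap_def add.assoc)
  moreover have "p + b + j * d < N'" if "j < k" for j
    using lt that assms(2) by (fastforce simp: add.assoc)
  ultimately show ?thesis unfolding has_constant_ap_def by blast
qed

lemma has_constant_ap_inj_on_comp:
  assumes "has_constant_ap N k (e \<circ> f)" and "inj_on e S" and "f \<in> {..<N} \<rightarrow> S"
  shows "has_constant_ap N k f"
proof -
  obtain b d where ap: "constant_ap (e \<circ> f) k b d" and lt: "\<And>j. j < k \<Longrightarrow> b + j * d < N"
    using assms(1) unfolding has_constant_ap_def by blast
  have "f (b + j * d) = f b" if "j < k" for j
  proof (rule inj_onD[OF assms(2)])
    show "e (f (b + j * d)) = e (f b)" using ap that by (simp add: constant_ap_def)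
    have "b < N" using lt[OF that] by simp
    then show "f (b + j * d) \<in> S" "f b \<in> S" using lt[OF that] assms(3) by auto
  qed
  then show ?thesis using ap lt unfolding has_constant_ap_def constant_ap_def by blast
qed

lemma vdW_bound_card_le:
  assumes "vdW_bound k T N" and "finite S" and "finite T" and "card S \<le> card T"
  shows "vdW_bound k S N"
  unfolding vdW_bound_def
proof
  fix f assume f: "f \<in> {..<N} \<rightarrow> S"
  obtain e where e: "e ` S \<subseteq> T" "inj_on e S" using card_le_inj[OF assms(2-4)] by blast
  have "e \<circ> f \<in> {..<N} \<rightarrow> T" using f e(1) by fastforce
  then have "has_constant_ap N k (e \<circ> f)" using assms(1) unfolding vdW_bound_def by blast
  then show "has_constant_ap N k f" using e(2) f by (rule has_constant_ap_inj_on_comp)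
qed

text \<open>Only progressions of length at most \<open>1\<close> leave the difference unbounded; for these it can be
  replaced by \<open>1\<close>.\<close>

lemma has_constant_ap_next_le:
  assumes "has_constant_ap N k f"
  obtains b d where "constant_ap f k b d" and "b + k * d \<le> 2 * N"
proof -
  obtain b d where ap: "constant_ap f k b d" and lt: "\<And>j. j < k \<Longrightarrow> b + j * d < N"
    using assms unfolding has_constant_ap_def by blast
  consider "k = 0" | "k = 1" | m where "k = Suc (Suc m)" by (metis One_nat_def not0_implies_Suc)
  then show ?thesis
  proof cases
    case 1
    then show ?thesis using that[of 0 1] by (simp add: constant_ap_def)
  next
    case 2
    then show ?thesis using that[of b 1] lt[of 0] by (simp add: constant_ap_def)
  next
    case 3
    then have "b + k * d \<le> 2 * N" using lt[of 1] lt[of "Suc m"] by simp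
    with ap show ?thesis by (rule that)
  qed
qed

lemma constant_ap_restrict_iff:
  "constant_ap (\<lambda>t. restrict (h t) P) k b d \<longleftrightarrow>
    0 < d \<and> (\<forall>j<k. \<forall>y\<in>P. h (b + j * d) y = h b y)"
proof -
  have "restrict (h t) P = restrict (h s) P \<longleftrightarrow> (\<forall>y\<in>P. h t y = h s y)" for s t
    by (auto simp: fun_eq_iff restrict_def)
  then show ?thesis by (simp add: constant_ap_def)
qed

lemma constant_blocks:
  assumes bound: "vdW_bound k (PiE {..<N} (\<lambda>_. S)) M"
    and "0 < N" and f: "f \<in> {..<(2 * M + 1) * N} \<rightarrow> S"
  obtains p e where "0 < e" and "p + k * e + N \<le> (2 * M + 1) * N"
    and "\<And>j y. j < k \<Longrightarrow> y < N \<Longrightarrow> f (p + j * e + y) = f (p + y)"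
proof -
  have fits: "t * N + N \<le> (2 * M + 1) * N" if "t \<le> 2 * M" for t
    using mult_le_mono1[of "t + 1" "2 * M + 1" N] that by simp
  define F where "F t = restrict (\<lambda>y. f (t * N + y)) {..<N}" for t
  have "t * N + y < (2 * M + 1) * N" if "t < M" "y < N" for t y
    using fits[of t] that by linarith
  then have "F t \<in> PiE {..<N} (\<lambda>_. S)" if "t < M" for t
    unfolding F_def restrict_PiE_iff using that by (intro ballI funcset_mem[OF f]) simp
  then have "has_constant_ap M k F" using bound unfolding vdW_bound_def by blast
  then obtain B D where ap: "constant_ap F k B D" and focus: "B + k * D \<le> 2 * M"
    by (rule has_constant_ap_next_le)
  have same: "f ((B + j * D) * N + y) = f (B * N + y)" if "j < k" "y < N" for j y
    using ap that unfolding F_def constant_ap_restrict_iff by auto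
  show ?thesis
  proof
    show "0 < D * N" using ap \<open>0 < N\<close> by (simp add: constant_ap_def)
    show "B * N + k * (D * N) + N \<le> (2 * M + 1) * N"
      using fits[OF focus] by (simp add: algebra_simps)
    show "f (B * N + j * (D * N) + y) = f (B * N + y)" if "j < k" "y < N" for j y
      using same[OF that] by (simp add: algebra_simps)
  qed
qed

definition focused :: "(nat \<Rightarrow> 'a) \<Rightarrow> nat \<Rightarrow> nat \<Rightarrow> 'a set \<Rightarrow> bool" where
  "focused f k z C \<longleftrightarrow> (\<forall>q\<in>C. \<exists>b d. constant_ap f k b d \<and> f b = q \<and> b + k * d = z)"

lemma has_constant_ap_focused:
  assumes "focused f k z C" and "f z \<in> C" and "z < N"
  shows "has_constant_ap N (Suc k) f"
proof -
  obtain b d where ap: "constant_ap f k b d" and "f b = f z" and z: "b + k * d = z"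
    using assms(1,2) unfolding focused_def by blast
  then have "constant_ap f (Suc k) b d" by (auto simp: constant_ap_def less_Suc_eq)
  moreover have "b + j * d < N" if "j < Suc k" for j
    using mult_le_mono1[of j k d] that z assms(3) by linarith
  ultimately show ?thesis unfolding has_constant_ap_def by blast
qed

lemma focused_shift_insert:
  assumes foc: "focused (\<lambda>y. f (p + y)) k z C" and "0 < e"
    and same: "\<And>j y. j < k \<Longrightarrow> y \<le> z \<Longrightarrow> f (p + j * e + y) = f (p + y)"
  shows "focused f k (p + k * e + z) (insert (f (p + z)) C)"
  unfolding focused_def
proof (rule ballI)
  fix q assume "q \<in> insert (f (p + z)) C"
  then consider "q = f (p + z)" | "q \<in> C" by blast
  then show "\<exists>b d. constant_ap f k b d \<and> f b = q \<and> b + k * d = p + k * e + z"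
  proof cases
    case 1
    have "constant_ap f k (p + z) e"
      using same[of _ z] \<open>0 < e\<close> by (simp add: constant_ap_def add.assoc add.commute[of z])
    then show ?thesis using 1 by (intro exI[of _ "p + z"] exI[of _ e]) simp
  next
    case 2
    then obtain b d where ap: "constant_ap (\<lambda>y. f (p + y)) k b d"
      and q: "f (p + b) = q" and z: "b + k * d = z"
      using foc unfolding focused_def by blast
    have "f (p + b + j * (d + e)) = f (p + b)" if "j < k" for j
    proof -
      have "b + j * d \<le> z" using that by (simp flip: z)
      have "f (p + b + j * (d + e)) = f (p + j * e + (b + j * d))" by (simp add: algebra_simps)
      also have "\<dots> = f (p + (b + j * d))" using that \<open>b + j * d \<le> z\<close> by (rule same)
      also have "\<dots> = f (p + b)" using ap that by (simp add: constant_ap_def)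
      finally show ?thesis .
    qed
    then have "constant_ap f k (p + b) (d + e)" using \<open>0 < e\<close> by (simp add: constant_ap_def)
    moreover have "p + b + k * (d + e) = p + k * e + z" by (simp add: z[symmetric] algebra_simps)
    ultimately show ?thesis using q by blast
  qed
qed

definition focusing_bound :: "nat \<Rightarrow> 'a set \<Rightarrow> nat \<Rightarrow> nat \<Rightarrow> bool" where
  "focusing_bound k S r N \<longleftrightarrow> (\<forall>f \<in> {..<N} \<rightarrow> S. has_constant_ap N (Suc k) f \<or>
    (\<exists>z<N. \<exists>C\<subseteq>S. card C = r \<and> focused f k z C))"

lemma focusing_bound_Suc:
  fixes M N :: nat
  defines "N' \<equiv> (2 * M + 1) * N"
  assumes "finite S" and bound: "focusing_bound k S r N"
    and M: "vdW_bound k (PiE {..<N} (\<lambda>_. S)) M"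
  shows "focusing_bound k S (Suc r) N'"
  unfolding focusing_bound_def
proof
  fix f assume f: "f \<in> {..<N'} \<rightarrow> S"
  have "0 < N" using bound by (cases "N = 0") (auto simp: focusing_bound_def has_constant_ap_def)
  obtain p e where "0 < e" and fits: "p + k * e + N \<le> N'"
    and same: "\<And>j y. j < k \<Longrightarrow> y < N \<Longrightarrow> f (p + j * e + y) = f (p + y)"
    by (rule constant_blocks[OF M \<open>0 < N\<close> f[unfolded N'_def], folded N'_def]) (rule that)
  define g where "g = (\<lambda>y. f (p + y))"
  have g: "g \<in> {..<N} \<rightarrow> S" using f fits by (auto simp: g_def)
  then have "has_constant_ap N (Suc k) g \<or> (\<exists>z<N. \<exists>C\<subseteq>S. card C = r \<and> focused g k z C)"
    using bound unfolding focusing_bound_def by (rule bspec[rotated])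
  then consider "has_constant_ap N (Suc k) g"
    | z C where "z < N" "C \<subseteq> S" "card C = r" "focused g k z C" "g z \<notin> C"
    using has_constant_ap_focused by blast
  then show "has_constant_ap N' (Suc k) f \<or>
      (\<exists>z<N'. \<exists>C\<subseteq>S. card C = Suc r \<and> focused f k z C)"
  proof cases
    case 1
    then have "has_constant_ap N' (Suc k) f"
      using has_constant_ap_shift[of N "Suc k" f p N'] fits by (simp add: g_def)
    then show ?thesis ..
  next
    case 2
    have "focused f k (p + k * e + z) (insert (g z) C)"
      unfolding g_def
    proof (rule focused_shift_insert)
      show "focused (\<lambda>y. f (p + y)) k z C" using 2 unfolding g_def by blast
      show "f (p + j * e + y) = f (p + y)" if "j < k" "y \<le> z" for j y
        using same[of j y] that 2 by simp
    qed fact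
    moreover have "card (insert (g z) C) = Suc r"
      using 2 finite_subset[OF _ \<open>finite S\<close>] by simp
    moreover have "insert (g z) C \<subseteq> S" using 2 g by blast
    moreover have "p + k * e + z < N'" using 2 fits by linarith
    ultimately show ?thesis by blast
  qed
qed

lemma colour_focusing:
  fixes S :: "'a set"
  assumes "finite S" and bounds: "\<And>T :: (nat \<Rightarrow> 'a) set. finite T \<Longrightarrow> \<exists>N. vdW_bound k T N"
  shows "\<exists>N. focusing_bound k S r N"
proof (induction r)
  case 0
  have "focusing_bound k S 0 1"
    by (auto simp: focusing_bound_def focused_def intro!: exI[of _ "{}"])
  then show ?case ..
next
  case (Suc r)
  then obtain N where N: "focusing_bound k S r N" ..
  have "finite (PiE {..<N} (\<lambda>_. S))" using \<open>finite S\<close> by (simp add: finite_PiE)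
  then obtain M where "vdW_bound k (PiE {..<N} (\<lambda>_. S)) M" using bounds by blast
  with \<open>finite S\<close> N show ?case by (blast intro: focusing_bound_Suc)
qed

theorem van_der_Waerden:
  fixes S :: "'a set"
  assumes "finite S"
  shows "\<exists>N. vdW_bound k S N"
proof -
  have nat_colours: "\<exists>N. vdW_bound k {..<c::nat} N" for c
  proof (induction k arbitrary: c)
    case 0
    show ?case by (auto simp: vdW_bound_def has_constant_ap_def constant_ap_def)
  next
    case (Suc k)
    have "\<exists>N. vdW_bound k T N" if "finite T" for T :: "(nat \<Rightarrow> nat) set"
      using Suc.IH[of "card T"] vdW_bound_card_le that by fastforce
    from colour_focusing[OF _ this, of "{..<c}" "Suc c"]
    obtain N where N: "focusing_bound k {..<c} (Suc c) N" by blast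
    have "card C \<noteq> Suc c" if "C \<subseteq> {..<c}" for C using card_mono[OF _ that] by auto
    then show ?case using N unfolding focusing_bound_def vdW_bound_def by blast
  qed
  then show ?thesis using vdW_bound_card_le[of k "{..<card S}"] assms by fastforce
qed

section \<open>Van der Waerden numbers\<close>

lemma vdW_bound_iff_monochromatic:
  "vdW_bound k {1..c} N \<longleftrightarrow> (\<forall>f \<in> {1..N} \<rightarrow> {1..c}.
    \<exists>b d q. d > 0 \<and> arith_prog b d k \<subseteq> {1..N} \<and> monochromatic f q (arith_prog b d k))"
  (is "_ \<longleftrightarrow> ?mono")
proof
  assume bound: "vdW_bound k {1..c} N"
  show ?mono
  proof
    fix f assume "f \<in> {1..N} \<rightarrow> {1..c}"
    then have "(\<lambda>x. f (Suc x)) \<in> {..<N} \<rightarrow> {1..c}" by auto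
    then obtain b d where "constant_ap (\<lambda>x. f (Suc x)) k b d" and "\<forall>j<k. b + j * d < N"
      using bound unfolding vdW_bound_def has_constant_ap_def by blast
    then have "d > 0 \<and> arith_prog (Suc b) d k \<subseteq> {1..N} \<and>
        monochromatic f (f (Suc b)) (arith_prog (Suc b) d k)"
      by (auto simp: constant_ap_def arith_prog_def monochromatic_def Suc_le_eq)
    then show "\<exists>b d q. d > 0 \<and> arith_prog b d k \<subseteq> {1..N} \<and> monochromatic f q (arith_prog b d k)"
      by blast
  qed
next
  assume mono: ?mono
  show "vdW_bound k {1..c} N"
    unfolding vdW_bound_def
  proof
    fix g :: "nat \<Rightarrow> nat" assume "g \<in> {..<N} \<rightarrow> {1..c}"
    then have "(\<lambda>x. g (x - 1)) \<in> {1..N} \<rightarrow> {1..c}" by (force simp: Pi_iff)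
    then obtain b d q where "d > 0" and sub: "arith_prog b d k \<subseteq> {1..N}"
      and q: "monochromatic (\<lambda>x. g (x - 1)) q (arith_prog b d k)"
      using mono by blast
    have member: "1 \<le> b + j * d \<and> b + j * d \<le> N \<and> g (b + j * d - 1) = q" if "j < k" for j
      using that sub q by (auto simp: arith_prog_def monochromatic_def)
    have "b - 1 + j * d < N \<and> g (b - 1 + j * d) = g (b - 1)" if "j < k" for j
      using member[OF that] member[of 0] that by auto
    then show "has_constant_ap N k g"
      using \<open>d > 0\<close> unfolding has_constant_ap_def constant_ap_def by blast
  qed
qed

lemma vdW_bound_vdW:
  assumes "finite S" and "card S \<le> c"
  shows "vdW_bound k S (vdW k c)"
proof -
  have "vdW k c = (LEAST N. vdW_bound k {1..c} N)"
    unfolding vdW_def vdW_bound_iff_monochromatic ..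
  then have "vdW_bound k {1..c} (vdW k c)"
    using LeastI_ex[OF van_der_Waerden[of "{1..c}" k]] by simp
  then show ?thesis using assms by (elim vdW_bound_card_le) auto
qed

lemma vdW_pos:
  assumes "0 < k"
  shows "0 < vdW k c"
proof -
  have "\<not> vdW_bound k {1..c} 0" using assms by (auto simp: vdW_bound_def has_constant_ap_def)
  then show ?thesis using vdW_bound_vdW[of "{1..c}" c k] by (cases "vdW k c = 0") auto
qed

lemma vdW_seq_pos:
  assumes "\<And>i. 1 \<le> i \<Longrightarrow> 0 < k i"
  shows "0 < vdW_seq k c i"
proof (cases i)
  case (Suc n)
  then show ?thesis using vdW_pos[OF assms[of i]] by simp
qed simp

lemma difference_le_div_length:
  fixes b d k N :: nat
  assumes "2 \<le> k" and "\<And>j. j < k \<Longrightarrow> b + j * d < N"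
  shows "d \<le> (N - 1) div (k - 1)"
proof -
  have "d * (k - 1) \<le> N - 1" using assms(2)[of "k - 1"] assms(1) by (simp add: mult.commute)
  then show ?thesis using assms(1) by (simp add: less_eq_div_iff_mult_less_eq)
qed

lemma vdW_constant_family:
  assumes "finite P" and "finite S" and "card S ^ card P \<le> c"
    and h: "\<And>t y. t < vdW k c \<Longrightarrow> y \<in> P \<Longrightarrow> h t y \<in> S"
  obtains s d where "0 < d" and "\<And>j. j < k \<Longrightarrow> s + j * d < vdW k c"
    and "\<And>j y. j < k \<Longrightarrow> y \<in> P \<Longrightarrow> h (s + j * d) y = h s y"
proof -
  have "vdW_bound k (PiE P (\<lambda>_. S)) (vdW k c)"
    using assms(1-3) by (intro vdW_bound_vdW finite_PiE) (auto simp: card_PiE)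
  moreover have "(\<lambda>t. restrict (h t) P) \<in> {..<vdW k c} \<rightarrow> PiE P (\<lambda>_. S)" using h by auto
  ultimately have "has_constant_ap (vdW k c) k (\<lambda>t. restrict (h t) P)"
    unfolding vdW_bound_def by blast
  then show ?thesis using that unfolding has_constant_ap_def constant_ap_restrict_iff by blast
qed

section \<open>Generalised progressions\<close>

lemma gen_prog_0: "gen_prog a d m 0 = {a}"
  by (auto simp: gen_prog_def)

lemma gen_prog_Suc:
  "gen_prog a d m (Suc n) = (\<Union>t\<le>m (Suc n) - 1. gen_prog (a + t * d (Suc n)) d m n)"
  (is "_ = ?translates")
proof (intro equalityI subsetI)
  fix y assume "y \<in> gen_prog a d m (Suc n)"
  then obtain x where x: "\<forall>j\<in>{1..Suc n}. x j \<le> m j - 1"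
    and "y = a + (\<Sum>j=1..Suc n. x j * d j)"
    by (auto simp: gen_prog_def)
  then have "y = a + x (Suc n) * d (Suc n) + (\<Sum>j=1..n. x j * d j)" by simp
  with x show "y \<in> ?translates" by (fastforce simp: gen_prog_def)
next
  fix y assume "y \<in> ?translates"
  then obtain t x where t: "t \<le> m (Suc n) - 1" and x: "\<forall>j\<in>{1..n}. x j \<le> m j - 1"
    and y: "y = a + t * d (Suc n) + (\<Sum>j=1..n. x j * d j)"
    by (auto simp: gen_prog_def)
  define x' where "x' = x(Suc n := t)"
  have "(\<Sum>j=1..n. x' j * d j) = (\<Sum>j=1..n. x j * d j)"
    by (intro sum.cong) (auto simp: x'_def)
  then have "y = a + (\<Sum>j=1..Suc n. x' j * d j)" using y by (simp add: x'_def)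
  moreover have "\<forall>j\<in>{1..Suc n}. 0 \<le> x' j \<and> x' j \<le> m j - 1"
    using x t by (auto simp: x'_def le_Suc_eq)
  ultimately show "y \<in> gen_prog a d m (Suc n)" unfolding gen_prog_def by blast
qed

lemma gen_prog_translate: "gen_prog (a + s) d m n = (\<lambda>y. y + s) ` gen_prog a d m n"
  unfolding gen_prog_def by (auto simp: image_iff algebra_simps)

lemma gen_prog_cong:
  assumes "\<And>i. i \<in> {1..n} \<Longrightarrow> d i = d' i"
  shows "gen_prog a d m n = gen_prog a d' m n"
proof -
  have "(\<Sum>j=1..n. x j * d j) = (\<Sum>j=1..n. x j * d' j)" for x :: "nat \<Rightarrow> nat"
    using assms by (intro sum.cong) auto
  then show ?thesis unfolding gen_prog_def by simp
qed

lemma gen_prog_mono: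
  assumes "i \<le> n"
  shows "gen_prog a d m i \<subseteq> gen_prog a d m n"
  using assms
proof (induction n rule: dec_induct)
  case (step n)
  have "gen_prog a d m n \<subseteq> gen_prog a d m (Suc n)" by (force simp: gen_prog_Suc)
  then show ?case using step.IH by blast
qed simp

lemma finite_gen_prog: "finite (gen_prog a d m n)"
  by (induction n arbitrary: a) (auto simp: gen_prog_0 gen_prog_Suc)

lemma card_gen_prog_le:
  assumes "\<And>i. i \<in> {1..n} \<Longrightarrow> 0 < m i"
  shows "card (gen_prog a d m n) \<le> (\<Prod>j=1..n. m j)"
  using assms
proof (induction n arbitrary: a)
  case 0
  show ?case by (simp add: gen_prog_0)
next
  case (Suc n)
  have "card (gen_prog a d m (Suc n))
      \<le> (\<Sum>t\<le>m (Suc n) - 1. card (gen_prog (a + t * d (Suc n)) d m n))"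
    unfolding gen_prog_Suc by (rule card_UN_le) simp
  also have "\<dots> \<le> (\<Sum>t\<le>m (Suc n) - 1. \<Prod>j=1..n. m j)"
    by (intro sum_mono Suc.IH Suc.prems) simp
  also have "\<dots> = (\<Prod>j=1..Suc n. m j)" using Suc.prems[of "Suc n"] by simp
  finally show ?case .
qed

lemma card_gen_prog_vdW_seq_le:
  assumes "\<And>i. 1 \<le> i \<Longrightarrow> 0 < k i"
  shows "card (gen_prog a d (vdW_seq k c) n) \<le> (\<Prod>j\<in>{0..n}. vdW_seq k c j)"
proof -
  have "card (gen_prog a d (vdW_seq k c) n) \<le> (\<Prod>j=1..n. vdW_seq k c j)"
    using vdW_seq_pos[of k] assms by (intro card_gen_prog_le) blast
  then show ?thesis by (simp add: prod.atLeast_Suc_atMost)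
qed

section \<open>Monochromatic generalised progressions\<close>

definition monochromatic_copy ::
  "(nat \<Rightarrow> nat) \<Rightarrow> nat \<Rightarrow> nat set \<Rightarrow> nat \<Rightarrow> (nat \<Rightarrow> nat) \<Rightarrow> (nat \<Rightarrow> nat) \<Rightarrow> nat \<Rightarrow> bool" where
  "monochromatic_copy f q S a d m n \<longleftrightarrow>
    (\<exists>b\<ge>a. gen_prog b d m n \<subseteq> S \<and> monochromatic f q (gen_prog b d m n))"

lemma monochromatic_copy_mono:
  assumes "monochromatic_copy f q S a d m n" and "S \<subseteq> T" and "a' \<le> a"
  shows "monochromatic_copy f q T a' d m n"
  using assms unfolding monochromatic_copy_def by (meson order_trans)

lemma monochromatic_copy_restrict:
  assumes "monochromatic_copy f q S a d m n" and "i \<le> n"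
    and "\<And>j. j \<in> {1..i} \<Longrightarrow> d' j = d j"
  shows "monochromatic_copy f q S a d' m i"
proof -
  obtain b where "a \<le> b" and sub: "gen_prog b d m n \<subseteq> S"
    and mono: "monochromatic f q (gen_prog b d m n)"
    using assms(1) unfolding monochromatic_copy_def by blast
  have "gen_prog b d' m i = gen_prog b d m i" by (rule gen_prog_cong) fact
  also have "\<dots> \<subseteq> gen_prog b d m n" using \<open>i \<le> n\<close> by (rule gen_prog_mono)
  finally show ?thesis
    using \<open>a \<le> b\<close> sub mono unfolding monochromatic_copy_def monochromatic_def by blast
qed

lemma monochromatic_copy_Suc:
  assumes "monochromatic_copy f q S a d m n" and "0 < m (Suc n)"
    and translate: "\<And>y t. y \<in> S \<Longrightarrow> t < m (Suc n) \<Longrightarrow>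
      y + t * d (Suc n) \<in> T \<and> f (y + t * d (Suc n)) = f y"
  shows "monochromatic_copy f q T a d m (Suc n)"
proof -
  obtain b where "a \<le> b" and sub: "gen_prog b d m n \<subseteq> S"
    and mono: "monochromatic f q (gen_prog b d m n)"
    using assms(1) unfolding monochromatic_copy_def by blast
  have "z \<in> T \<and> f z = q" if z: "z \<in> gen_prog b d m (Suc n)" for z
  proof -
    obtain t y where "t \<le> m (Suc n) - 1" and y: "y \<in> gen_prog b d m n"
      and z: "z = y + t * d (Suc n)"
      using z unfolding gen_prog_Suc gen_prog_translate by blast
    then have "t < m (Suc n)" using assms(2) by simp
    then have "z \<in> T \<and> f z = f y" using translate[of y t] y sub unfolding z by blast
    then show ?thesis using mono y by (simp add: monochromatic_def)
  qed
  then show ?thesis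
    using \<open>a \<le> b\<close> unfolding monochromatic_copy_def monochromatic_def by blast
qed

abbreviation max_multiplier :: "(nat \<Rightarrow> nat) \<Rightarrow> nat \<Rightarrow> nat \<Rightarrow> nat" where
  "max_multiplier k c i \<equiv> (vdW_seq k c i - 1) div (k i - 1)"

lemma vdW_seq_constant_translates:
  fixes k l :: "nat \<Rightarrow> nat" and c n :: nat
  defines "W \<equiv> vdW_seq k c" and "L \<equiv> l (Suc n)"
  assumes "1 \<le> c" and k: "\<And>i. 1 \<le> i \<Longrightarrow> 2 \<le> k i" and f: "f \<in> gen_prog a l W (Suc n) \<rightarrow> {1..c}"
  shows "\<exists>s. \<exists>d\<in>{1..max_multiplier k c (Suc n)}.
    gen_prog (a + s * L) l W n \<subseteq> gen_prog a l W (Suc n) \<and>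
    (\<forall>y\<in>gen_prog (a + s * L) l W n. \<forall>t<k (Suc n).
      y + t * (d * L) \<in> gen_prog a l W (Suc n) \<and> f (y + t * (d * L)) = f y)"
proof -
  define P where "P = gen_prog a l W n"
  define C where "C = c ^ (\<Prod>j\<in>{0..n}. W j)"
  have W_Suc: "W (Suc n) = vdW (k (Suc n)) C" by (simp add: W_def C_def)
  have translate: "y + t * L \<in> gen_prog a l W (Suc n)" if "t < W (Suc n)" "y \<in> P" for y t
    using that by (force simp: P_def L_def gen_prog_Suc gen_prog_translate)
  have "0 < k i" if "1 \<le> i" for i using k[OF that] by simp
  then have "card P \<le> (\<Prod>j\<in>{0..n}. W j)"
    unfolding P_def W_def by (intro card_gen_prog_vdW_seq_le) blast
  then have "card {1..c} ^ card P \<le> C" using \<open>1 \<le> c\<close> by (simp add: C_def power_increasing)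
  moreover have "finite P" by (simp add: P_def finite_gen_prog)
  moreover have "f (y + t * L) \<in> {1..c}" if "t < vdW (k (Suc n)) C" "y \<in> P" for t y
    using f translate that unfolding W_Suc by blast
  ultimately obtain s d where "0 < d"
    and lt: "\<And>j. j < k (Suc n) \<Longrightarrow> s + j * d < W (Suc n)"
    and same: "\<And>j y. j < k (Suc n) \<Longrightarrow> y \<in> P \<Longrightarrow> f (y + (s + j * d) * L) = f (y + s * L)"
    using vdW_constant_family[of P "{1..c}" C "k (Suc n)" "\<lambda>t y. f (y + t * L)"]
    unfolding W_Suc by (metis finite_atLeastAtMost)
  show ?thesis
  proof (intro exI bexI conjI ballI allI impI)
    show "d \<in> {1..max_multiplier k c (Suc n)}"
      using \<open>0 < d\<close> difference_le_div_length[OF k lt] by (simp add: W_def)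
    show "gen_prog (a + s * L) l W n \<subseteq> gen_prog a l W (Suc n)"
      using lt[of 0] k[of "Suc n"] translate by (auto simp: gen_prog_translate P_def)
    fix y t assume "y \<in> gen_prog (a + s * L) l W n" and t: "t < k (Suc n)"
    then obtain x where x: "x \<in> P" "y = x + s * L" by (auto simp: gen_prog_translate P_def)
    have "y + t * (d * L) = x + (s + t * d) * L" by (simp add: x(2) algebra_simps)
    then show "y + t * (d * L) \<in> gen_prog a l W (Suc n)" "f (y + t * (d * L)) = f y"
      using translate[OF lt[OF t] x(1)] same[OF t x(1)] by (simp_all only: x(2))
  qed
qed

lemma monochromatic_copy_gen_prog_level:
  assumes "1 \<le> c" and k: "\<And>i. 1 \<le> i \<Longrightarrow> 2 \<le> k i"
    and "f \<in> gen_prog a l (vdW_seq k c) n \<rightarrow> {1..c}"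
  shows "\<exists>q\<in>{1..c}. \<exists>\<alpha> \<in> (\<Pi> i\<in>{1..n}. {1..max_multiplier k c i}).
    monochromatic_copy f q (gen_prog a l (vdW_seq k c) n) a (\<lambda>i. \<alpha> i * l i) k n"
  using assms(3)
proof (induction n arbitrary: a)
  case 0
  then show ?case by (auto simp: monochromatic_copy_def gen_prog_0 monochromatic_def)
next
  case (Suc n)
  define W where "W = vdW_seq k c"
  define L where "L = l (Suc n)"
  obtain s d where d: "d \<in> {1..max_multiplier k c (Suc n)}"
    and sub: "gen_prog (a + s * L) l W n \<subseteq> gen_prog a l W (Suc n)"
    and same: "\<And>y t. y \<in> gen_prog (a + s * L) l W n \<Longrightarrow> t < k (Suc n) \<Longrightarrow>
      y + t * (d * L) \<in> gen_prog a l W (Suc n) \<and> f (y + t * (d * L)) = f y"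
    using vdW_seq_constant_translates[OF assms(1) k Suc.prems] unfolding W_def L_def by blast
  have "f \<in> gen_prog (a + s * L) l (vdW_seq k c) n \<rightarrow> {1..c}"
    using Suc.prems sub unfolding W_def by blast
  from Suc.IH[OF this] obtain q \<alpha> where q: "q \<in> {1..c}"
    and \<alpha>: "\<alpha> \<in> (\<Pi> i\<in>{1..n}. {1..max_multiplier k c i})"
    and copy: "monochromatic_copy f q (gen_prog (a + s * L) l W n) (a + s * L) (\<lambda>i. \<alpha> i * l i) k n"
    unfolding W_def by blast
  define \<alpha>' where "\<alpha>' = \<alpha>(Suc n := d)"
  have "monochromatic_copy f q (gen_prog (a + s * L) l W n) (a + s * L) (\<lambda>i. \<alpha>' i * l i) k n"
    by (rule monochromatic_copy_restrict[OF copy]) (simp_all add: \<alpha>'_def)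
  then have "monochromatic_copy f q (gen_prog a l W (Suc n)) (a + s * L) (\<lambda>i. \<alpha>' i * l i) k (Suc n)"
    using k[of "Suc n"] same by (intro monochromatic_copy_Suc) (auto simp: \<alpha>'_def L_def)
  then have "monochromatic_copy f q (gen_prog a l W (Suc n)) a (\<lambda>i. \<alpha>' i * l i) k (Suc n)"
    by (rule monochromatic_copy_mono) simp_all
  moreover have "\<alpha>' \<in> (\<Pi> i\<in>{1..Suc n}. {1..max_multiplier k c i})"
    using \<alpha> d by (auto simp: \<alpha>'_def Pi_iff le_Suc_eq)
  ultimately show ?case using q unfolding W_def by blast
qed

lemma diagonal_pointwise_stable:
  fixes x :: "nat \<Rightarrow> nat \<Rightarrow> 'a"
  assumes "\<And>i. finite (range (\<lambda>n. x n i))"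
  obtains s y where "strict_mono s" and "\<And>i n. i < n \<Longrightarrow> x (s n) i = y i"
proof -
  interpret subseqs "\<lambda>i s. \<forall>m n. x (s m) i = x (s n) i"
  proof
    fix i and s :: "nat \<Rightarrow> nat"
    have "finite (range (\<lambda>n. x (s n) i))" by (rule finite_subset[OF _ assms[of i]]) auto
    then obtain v where "infinite {n. x (s n) i = x (s v) i}"
      using pigeonhole_infinite[of UNIV "\<lambda>n. x (s n) i"] by auto
    from infinite_enumerate[OF this] obtain r :: "nat \<Rightarrow> nat"
      where "strict_mono r" and "\<And>n. x (s (r n)) i = x (s v) i" by auto
    then show "\<exists>r :: nat \<Rightarrow> nat. strict_mono r \<and> (\<forall>m n. x ((s \<circ> r) m) i = x ((s \<circ> r) n) i)"
      by (intro exI[of _ r]) simp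
  qed
  have stable: "\<forall>m n. x ((diagseq \<circ> (+) (Suc i)) m) i = x ((diagseq \<circ> (+) (Suc i)) n) i" for i
    by (rule diagseq_holds) simp
  have "x (diagseq n) i = x (diagseq (Suc i)) i" if "i < n" for i n
    using stable[of i, rule_format, of "n - Suc i" 0] that by simp
  with subseq_diagseq show ?thesis by (rule that)
qed

lemma monochromatic_copy_all_levels:
  assumes "finite C" and finite_B: "\<And>i. finite (B i)"
    and levels: "\<And>n. \<exists>q\<in>C. \<exists>\<alpha> \<in> (\<Pi> i\<in>{1..n}. B i).
      monochromatic_copy f q S a (\<lambda>i. \<alpha> i * l i) m n"
  shows "\<exists>q\<in>C. \<exists>\<alpha> \<in> (\<Pi> i\<in>{1..}. B i). \<forall>n. monochromatic_copy f q S a (\<lambda>i. \<alpha> i * l i) m n"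
proof -
  obtain p \<beta> where p: "\<And>n. p n \<in> C" and \<beta>: "\<And>n. \<beta> n \<in> (\<Pi> i\<in>{1..n}. B i)"
    and copy: "\<And>n. monochromatic_copy f (p n) S a (\<lambda>i. \<beta> n i * l i) m n"
    using levels by metis
  have "finite (range (\<lambda>n. (p n, \<beta> n (Suc i))))" for i
  proof (rule finite_subset)
    have "(p n, \<beta> n (Suc i)) \<in> (\<lambda>n. (p n, \<beta> n (Suc i))) ` {..i} \<union> C \<times> B (Suc i)" for n
      using p[of n] Pi_mem[OF \<beta>[of n], of "Suc i"] by (cases "n \<le> i") auto
    then show "range (\<lambda>n. (p n, \<beta> n (Suc i))) \<subseteq> (\<lambda>n. (p n, \<beta> n (Suc i))) ` {..i} \<union> C \<times> B (Suc i)"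
      by blast
    show "finite \<dots>" using \<open>finite C\<close> finite_B by simp
  qed
  then obtain s \<gamma> where s: "strict_mono s"
    and \<gamma>: "\<And>i n. i < n \<Longrightarrow> (p (s n), \<beta> (s n) (Suc i)) = \<gamma> i"
    by (rule diagonal_pointwise_stable) (rule that)
  define q where "q = fst (\<gamma> 0)"
  define \<alpha> where "\<alpha> i = snd (\<gamma> (i - 1))" for i
  have q: "p (s (Suc n)) = q" for n using \<gamma>[of 0 "Suc n", symmetric] by (simp add: q_def)
  have \<alpha>: "\<beta> (s n) i = \<alpha> i" if "i \<in> {1..n}" for i n
    using \<gamma>[of "i - 1" n, symmetric] that by (cases i) (auto simp: \<alpha>_def)
  have le_s: "n \<le> s n" for n using s by (rule seq_suble)
  show ?thesis
  proof (intro bexI allI Pi_I)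
    show "\<alpha> i \<in> B i" if "i \<in> {1..}" for i
      using Pi_mem[OF \<beta>[of "s i"], of i] le_s[of i] \<alpha>[of i i] that by simp
    show "q \<in> C" using p[of "s 1"] q[of 0] by simp
    fix n
    have "monochromatic_copy f q S a (\<lambda>i. \<beta> (s (Suc n)) i * l i) m (s (Suc n))"
      using copy[of "s (Suc n)"] by (simp add: q)
    then show "monochromatic_copy f q S a (\<lambda>i. \<alpha> i * l i) m n"
      using le_s[of "Suc n"] \<alpha>[of _ "Suc n"] by (elim monochromatic_copy_restrict) auto
  qed
qed

lemma monochromatic_copy_gen_prog_Union:
  fixes k l :: "nat \<Rightarrow> nat" and a c :: nat
  defines "A \<equiv> \<Union>i\<in>{1..}. gen_prog a l (vdW_seq k c) i"
  assumes "1 \<le> c" and k: "\<And>i. 1 \<le> i \<Longrightarrow> 2 \<le> k i" and f: "f \<in> A \<rightarrow> {1..c}"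
  shows "\<exists>q\<in>{1..c}. \<exists>\<alpha> \<in> (\<Pi> i\<in>{1..}. {1..max_multiplier k c i}).
    \<forall>n. monochromatic_copy f q A a (\<lambda>i. \<alpha> i * l i) k n"
proof (rule monochromatic_copy_all_levels)
  fix n
  have A: "gen_prog a l (vdW_seq k c) n \<subseteq> A"
    using gen_prog_mono[of n "Suc n" a l "vdW_seq k c"] unfolding A_def by fastforce
  then have "f \<in> gen_prog a l (vdW_seq k c) n \<rightarrow> {1..c}" using f by blast
  from monochromatic_copy_gen_prog_level[OF \<open>1 \<le> c\<close> k this]
  show "\<exists>q\<in>{1..c}. \<exists>\<alpha> \<in> (\<Pi> i\<in>{1..n}. {1..max_multiplier k c i}).
      monochromatic_copy f q A a (\<lambda>i. \<alpha> i * l i) k n"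
    by (blast intro: monochromatic_copy_mono[OF _ A order_refl])
qed simp_all

theorem theorem2p2:
  fixes a c :: nat and k l :: "nat \<Rightarrow> nat" and A :: "nat set" and f :: "nat \<Rightarrow> nat"
  assumes "a \<ge> 1" and "c \<ge> 1"
    and "2 \<le> k 1" and "\<And>i. i \<ge> 1 \<Longrightarrow> k i \<le> k (i + 1)"
    and "\<And>i. i \<ge> 1 \<Longrightarrow> l i \<ge> 1"
    and "\<And>i. i \<ge> 2 \<Longrightarrow> l i > (\<Sum>j=1..i-1. (vdW_seq k c j - 1) * l j)"
    and "A = (\<Union>i\<in>{1..}. gen_prog a l (vdW_seq k c) i)"
    and "f \<in> A \<rightarrow> {1..c}"
  shows "\<exists>(b :: nat \<Rightarrow> nat) (d :: nat \<Rightarrow> nat) (\<alpha> :: nat \<Rightarrow> nat).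
      (\<forall>i\<ge>1. b i \<ge> 1 \<and> d i \<ge> 1 \<and> d i = \<alpha> i * l i \<and>
         1 \<le> \<alpha> i \<and> \<alpha> i \<le> (vdW_seq k c i - 1) div (k i - 1)) \<and>
      (\<forall>i\<ge>1. gen_prog (b i) d k i \<subseteq> A) \<and>
      (\<exists>q\<in>{1..c}. \<forall>i\<ge>1. monochromatic f q (gen_prog (b i) d k i))"
proof -
  have k: "2 \<le> k i" if "1 \<le> i" for i
    using lift_Suc_mono_le[of "\<lambda>i. k (Suc i)" 0 "i - 1"] assms(3,4) that by simp
  obtain q \<alpha> where q: "q \<in> {1..c}" and \<alpha>: "\<alpha> \<in> (\<Pi> i\<in>{1..}. {1..max_multiplier k c i})"
    and "\<And>n. monochromatic_copy f q A a (\<lambda>i. \<alpha> i * l i) k n"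
    using monochromatic_copy_gen_prog_Union[OF assms(2) k assms(8)[unfolded assms(7)]]
    unfolding assms(7) by blast
  then obtain b where b: "\<And>n. a \<le> b n" "\<And>n. gen_prog (b n) (\<lambda>i. \<alpha> i * l i) k n \<subseteq> A"
    "\<And>n. monochromatic f q (gen_prog (b n) (\<lambda>i. \<alpha> i * l i) k n)"
    unfolding monochromatic_copy_def by metis
  show ?thesis
  proof (rule exI[of _ b], rule exI[of _ "\<lambda>i. \<alpha> i * l i"], rule exI[of _ \<alpha>],
      intro conjI allI impI bexI[of _ q])
    fix i :: nat assume "1 \<le> i"
    then show "1 \<le> \<alpha> i" "\<alpha> i \<le> max_multiplier k c i" "1 \<le> \<alpha> i * l i"
      using Pi_mem[OF \<alpha>, of i] assms(5) by auto
    show "1 \<le> b i" using assms(1) b(1) by (rule order_trans)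
  qed (use b q in auto)
qed

end
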